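(* Let $\mathcal{N}_1\subseteq\Omega^2$ be the set of Riemann data violating the constraint for $\mathcal{R}_1$ (see context). For any $(u_\ell,u_r)\in\mathcal{N}_1$, a pair $(\hat u,\check u)\in\Omega_{\rm c}\times\Omega$ is uniquely selected by the two conditions (A) $\mathcal{R}_1[u_\ell,\hat u](0^-)=\hat u$, $\mathcal{R}_1[\check u,u_r](0^+)=\check u$, $Q(\hat u)=Q(\check u)\le Q_0$, $W(\hat u)=W(u_\ell)$; (B) if $(\hat u',\check u')\in\Omega^2\setminus\{(\hat u,\check u)\}$ satisfies (A), then $Q(\hat u')<Q(\hat u)$. This pair is given as follows, with $w_\ell=W(u_\ell)$, $u_r=(\rho_r,v_r)$, $\check u=(\check\rho,\check v)$. 1. If $(u_\ell,u_r)\in\mathcal{N}^1\cup\mathcal{N}^3$: (1a) if $Q_0>Q(u_{\rm c}(w_\ell))$, then $\hat u=u_{\rm c}(w_\ell)$, $Q(\check u)=Q(\hat u)$ and $\check u\in\Omega_{\rm f}$; (1b) if $Q_0\le Q(u_{\rm c}(w_\ell))$, then $W(\hat u)=w_\ell$, $Q(\hat u)=Q(\check u)=Q_0$ and $\check u\in\Omega_{\rm f}$. 2. If $(u_\ell,u_r)\in\mathcal{N}^2\cup\mathcal{N}^4_1$: (2a) if $Q_0\ge p^{-1}(W_{\rm c}-v_r)\,v_r$, then $W(\hat u)=w_\ell$, $Q(\hat u)=Q(\check u)=Q_0$ and $\check v=v_r$; (2b) if $Q_0<p^{-1}(W_{\rm c}-v_r)\,v_r$, then $W(\hat u)=w_\ell$,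 $Q(\hat u)=Q(\check u)=Q_0$ and $\check u\in\Omega_{\rm f}'$.
   Context: **Data.** Fix $R_{\rm f}''>R_{\rm f}'>0$, $V\in C^2([0,R_{\rm f}''];[0,\infty))$ with $V(R_{\rm f}'')>0$, and $p\in C^2((0,+\infty);\mathbb{R})$ such that: for all $\rho\in[0,R_{\rm f}'']$, $V'(\rho)\le0$, $V(\rho)+\rho V'(\rho)>0$, $2V'(\rho)+\rho V''(\rho)\le0$; for all $\rho\in(0,+\infty)$, $p'(\rho)>0$, $2p'(\rho)+\rho p''(\rho)>0$; for all $\rho\in[R_{\rm f}',R_{\rm f}'']$, $V'(\rho)+p'(\rho)>0$, $V(\rho)<\rho p'(\rho)$. Put $V_{\max}=V(0)$, $V_{\min}=V(R_{\rm f}'')$, $W_{\max}=p(R_{\rm f}'')+V_{\min}$, $W_{\rm c}=p(R_{\rm f}')+V(R_{\rm f}')$, $R_{\max}=p^{-1}(W_{\max})$, $q_{\max}=R_{\rm f}''V_{\min}$. Fix $V_{\rm c}\in(0,V_{\min}]$ and $Q_0\in(0,q_{\max})$. **State space.** States are $u=(\rho,v)$ (density, speed). $\Omega_{\rm f}=\{u\in[0,R_{\rm f}'']\times[V_{\min},V_{\max}]: v=V(\rho)\}$, $\Omega_{\rm c}=\{u\in[R_{\rm f}',R_{\max}]\times[0,V_{\rm c}]: W_{\rm c}\le v+p(\rho)\le W_{\max}\}$, $\Omega=\Omega_{\rm f}\cup\Omega_{\rm c}$, $\Omega_{\rm f}'=\{u\in\Omega_{\rm f}:\rho<R_{\rm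 f}'\}$, $\Omega_{\rm f}''=\{u\in\Omega_{\rm f}:\rho\ge R_{\rm f}'\}$. $Q(u)=\rho v$; $W(u)=v+p(\rho)$ if $u\in\Omega_{\rm c}\cup\Omega_{\rm f}''$ and $W(u)=W_{\rm c}$ if $u\in\Omega_{\rm f}'$. Subscripts carry over: $u_*=(\rho_*,v_* )$, $q_*=Q(u_* )$, $w_*=W(u_* )$. For $w\in[W_{\rm c},W_{\max}]$: $u_{\rm c}(w)=(p^{-1}(w-V_{\rm c}),V_{\rm c})\in\Omega_{\rm c}$, and $u_{\rm f}(w)=(\rho_{\rm f}(w),v_{\rm f}(w))\in\Omega_{\rm f}''$ is defined by $v_{\rm f}(w)=V(\rho_{\rm f}(w))=w-p(\rho_{\rm f}(w))$. For $\rho_\ell\ne\rho_r$, $\sigma(u_\ell,u_r)=(q_r-q_\ell)/(\rho_r-\rho_\ell)$. **Riemann solvers.** For Riemann data $u_\ell$ ($x<0$), $u_r$ ($x>0$), a Riemann solver gives the self-similar profile, a function of $x$ (solution $(t,x)\mapsto\mathcal{R}[u_\ell,u_r](x/t)$). $\mathcal{R}_{\rm LWR}$ is the standard (entropy) Riemann solver for $\rho_t+(\rho V(\rho))_x=0$, $v=V(\rho)$, in $\Omega_{\rm f}$ (concave flux). $\mathcal{R}_{\rm ARZ}$ is the standard (Lax) Riemann solver for the Aw–Rascle–Zhang system $\rho_t+(\rho v)_x=0$, $(\rho W)_t+(\rho vW)_x=0$ with $W=v+p(\rho)$ in $\Omega_{\rm c}$: $u_\ell$ is joined to $(p^{-1}(w_\ell-v_r),v_r)$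 by a 1-wave (shock if $v_r<v_\ell$, rarefaction if $v_r>v_\ell$; $\lambda_1=v-\rho p'(\rho)$), which is joined to $u_r$ by a contact discontinuity of speed $v_r$. $\mathcal{R}_1$ on $\Omega^2$: $\mathcal{R}_1=\mathcal{R}_{\rm LWR}$ on $\Omega_{\rm f}^2$; $\mathcal{R}_1=\mathcal{R}_{\rm ARZ}$ on $\Omega_{\rm c}^2$; if $(u_\ell,u_r)\in\Omega_{\rm f}\times\Omega_{\rm c}$, with $u_m=(p^{-1}(w_\ell-v_r),v_r)$, $\mathcal{R}_1[u_\ell,u_r](x)=u_\ell$ for $x<\sigma(u_\ell,u_m)$ and $=\mathcal{R}_{\rm ARZ}[u_m,u_r](x)$ for $x>\sigma(u_\ell,u_m)$; if $(u_\ell,u_r)\in\Omega_{\rm c}\times\Omega_{\rm f}$, $\mathcal{R}_1[u_\ell,u_r](x)=\mathcal{R}_{\rm ARZ}[u_\ell,u_{\rm c}(w_\ell)](x)$ for $x<\sigma(u_{\rm c}(w_\ell),u_{\rm f}(w_\ell))$ and $=\mathcal{R}_{\rm LWR}[u_{\rm f}(w_\ell),u_r](x)$ for $x>\sigma(u_{\rm c}(w_\ell),u_{\rm f}(w_\ell))$. **Constraint sets.** $\mathcal{N}_1=\{(u_\ell,u_r)\in\Omega^2: Q(\mathcal{R}_1[u_\ell,u_r](0^\pm))>Q_0\}=\mathcal{N}^1\cup\mathcal{N}^2\cup\mathcal{N}^3\cup\mathcal{N}_1^4$, where $\mathcal{N}^1=\Omega_{\rm f}^2\setminus\{q_\ell\le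 Q_0\}$; $\mathcal{N}^2=\Omega_{\rm c}^2\setminus\{p^{-1}(w_\ell-v_r)v_r\le Q_0\}$; $\mathcal{N}^3=(\Omega_{\rm c}\times\Omega_{\rm f})\setminus\{Q(u_{\rm f}(w_\ell))\le Q_0\}$; $\mathcal{N}_1^4=(\Omega_{\rm f}\times\Omega_{\rm c})\setminus\{\min\{q_\ell,p^{-1}(w_\ell-v_r)v_r\}\le Q_0\}$.
   Formalization: If V_c = V_min, Ω_f and Ω_c overlap and the cases of R_1 and of N^1, N^2, N^3, N_1^4 conflict; states in both phases are counted as free-flow there (Ω_c is replaced by Ω_c \ Ω_f in R_1 and these sets). Nothing changes for V_c < V_min. *)

theory Defs
  imports "HOL-Analysis.Analysis"
begin

type_synonym state = "real \<times> real"  \<comment> \<open>(density, speed)\<close>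

text \<open>
  The functions \<open>Vel\<close> and \<open>pr\<close> are the maps written V and p in the literature; only their values on
  [0, Rf''] and on (0, \<open>\<infinity>\<close>) respectively are ever used.  Their first and second derivatives are
  recorded as separate fields, since derivatives of \<open>Vel\<close> are one-sided at 0 and Rf''.
\<close>

record model =
  Rf' :: real
  Rf'' :: real
  Vel :: "real \<Rightarrow> real"
  Vel' :: "real \<Rightarrow> real"
  Vel'' :: "real \<Rightarrow> real"
  pr :: "real \<Rightarrow> real"
  pr' :: "real \<Rightarrow> real"
  pr'' :: "real \<Rightarrow> real"
  Vc :: real
  Q0 :: real

definition Vmax :: "model \<Rightarrow> real" where
  "Vmax D = Vel D 0"

definition Vmin :: "model \<Rightarrow> real" where
  "Vmin D = Vel D (Rf'' D)"

definition Wmax :: "model \<Rightarrow> real" where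
  "Wmax D = pr D (Rf'' D) + Vmin D"

definition Wc :: "model \<Rightarrow> real" where
  "Wc D = pr D (Rf' D) + Vel D (Rf' D)"

definition pinv :: "model \<Rightarrow> real \<Rightarrow> real" where
  "pinv D = the_inv_into {0<..} (pr D)"

definition Rmax :: "model \<Rightarrow> real" where
  "Rmax D = pinv D (Wmax D)"

definition qmax :: "model \<Rightarrow> real" where
  "qmax D = Rf'' D * Vmin D"

locale phase_transition_model =
  fixes D :: model
  assumes Rf: "0 < Rf' D" "Rf' D < Rf'' D"
    and Vel_C2:
      "\<And>\<rho>. \<rho> \<in> {0..Rf'' D} \<Longrightarrow> (Vel D has_real_derivative Vel' D \<rho>) (at \<rho> within {0..Rf'' D})"
      "\<And>\<rho>. \<rho> \<in> {0..Rf'' D} \<Longrightarrow> (Vel' D has_real_derivative Vel'' D \<rho>) (at \<rho> within {0..Rf'' D})"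
      "continuous_on {0..Rf'' D} (Vel'' D)"
    and Vel_nonneg: "\<And>\<rho>. \<rho> \<in> {0..Rf'' D} \<Longrightarrow> 0 \<le> Vel D \<rho>"
    and Vel_pos: "0 < Vel D (Rf'' D)"
    and pr_C2:
      "\<And>\<rho>. 0 < \<rho> \<Longrightarrow> (pr D has_real_derivative pr' D \<rho>) (at \<rho>)"
      "\<And>\<rho>. 0 < \<rho> \<Longrightarrow> (pr' D has_real_derivative pr'' D \<rho>) (at \<rho>)"
      "continuous_on {0<..} (pr'' D)"
    and Vel_cond:
      "\<And>\<rho>. \<rho> \<in> {0..Rf'' D} \<Longrightarrow> Vel' D \<rho> \<le> 0"
      "\<And>\<rho>. \<rho> \<in> {0..Rf'' D} \<Longrightarrow> Vel D \<rho> + \<rho> * Vel' D \<rho> > 0"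
      "\<And>\<rho>. \<rho> \<in> {0..Rf'' D} \<Longrightarrow> 2 * Vel' D \<rho> + \<rho> * Vel'' D \<rho> \<le> 0"
    and pr_cond:
      "\<And>\<rho>. 0 < \<rho> \<Longrightarrow> pr' D \<rho> > 0"
      "\<And>\<rho>. 0 < \<rho> \<Longrightarrow> 2 * pr' D \<rho> + \<rho> * pr'' D \<rho> > 0"
    and Vel_pr_cond:
      "\<And>\<rho>. \<rho> \<in> {Rf' D..Rf'' D} \<Longrightarrow> Vel' D \<rho> + pr' D \<rho> > 0"
      "\<And>\<rho>. \<rho> \<in> {Rf' D..Rf'' D} \<Longrightarrow> Vel D \<rho> < \<rho> * pr' D \<rho>"
    and Vc: "0 < Vc D" "Vc D \<le> Vmin D"
    and Q0: "0 < Q0 D" "Q0 D < qmax D"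

definition Omega_f :: "model \<Rightarrow> state set" where
  "Omega_f D = {(\<rho>, v). \<rho> \<in> {0..Rf'' D} \<and> v \<in> {Vmin D..Vmax D} \<and> v = Vel D \<rho>}"

definition Omega_c :: "model \<Rightarrow> state set" where
  "Omega_c D = {(\<rho>, v). \<rho> \<in> {Rf' D..Rmax D} \<and> v \<in> {0..Vc D} \<and>
                        Wc D \<le> v + pr D \<rho> \<and> v + pr D \<rho> \<le> Wmax D}"

definition Omega :: "model \<Rightarrow> state set" where
  "Omega D = Omega_f D \<union> Omega_c D"

definition Omega_f' :: "model \<Rightarrow> state set" where
  "Omega_f' D = {u \<in> Omega_f D. fst u < Rf' D}"

definition Omega_f'' :: "model \<Rightarrow> state set" where
  "Omega_f'' D = {u \<in> Omega_f D. fst u \<ge> Rf' D}"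

definition Q :: "state \<Rightarrow> real" where
  "Q u = fst u * snd u"

definition W :: "model \<Rightarrow> state \<Rightarrow> real" where
  "W D u = (if u \<in> Omega_c D \<union> Omega_f'' D then snd u + pr D (fst u) else Wc D)"

definition u_c :: "model \<Rightarrow> real \<Rightarrow> state" where
  "u_c D w = (pinv D (w - Vc D), Vc D)"

definition u_f :: "model \<Rightarrow> real \<Rightarrow> state" where
  "u_f D w = (THE u. u \<in> Omega_f'' D \<and> snd u = Vel D (fst u) \<and> snd u = w - pr D (fst u))"

definition \<sigma> :: "state \<Rightarrow> state \<Rightarrow> real" where
  "\<sigma> ul ur = (Q ur - Q ul) / (fst ur - fst ul)"

text \<open>
  A Riemann solver maps a pair of data to a profile in the variable x/t.  Profiles are relevant up to
  countably many points only (all later uses are through one-sided limits), so the value chosen at a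
  jump is immaterial.  In particular the flux \<open>\<rho> V(\<rho>)\<close> is only weakly concave, so in a rarefaction
  the equation for \<open>\<rho>\<close> may have a whole interval of solutions for some exceptional speeds x (at which
  the profile jumps); \<open>Inf\<close> then selects one of them.
\<close>

definition R_LWR :: "model \<Rightarrow> state \<Rightarrow> state \<Rightarrow> real \<Rightarrow> state" where
  "R_LWR D ul ur x =
    (let speed = (\<lambda>\<rho>. Vel D \<rho> + \<rho> * Vel' D \<rho>) in
     if fst ul < fst ur then (if x < \<sigma> ul ur then ul else ur)
     else if x < speed (fst ul) then ul
     else if x > speed (fst ur) then ur
     else (let r = Inf {\<rho> \<in> {fst ur..fst ul}. speed \<rho> = x} in (r, Vel D r)))"

definition lambda1 :: "model \<Rightarrow> state \<Rightarrow> real" where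
  "lambda1 D u = snd u - fst u * pr' D (fst u)"

definition u_mid :: "model \<Rightarrow> state \<Rightarrow> state \<Rightarrow> state" where
  "u_mid D ul ur = (pinv D (W D ul - snd ur), snd ur)"

text \<open>The 1-wave joins two states with the same Lagrangian marker W.\<close>

definition wave1 :: "model \<Rightarrow> state \<Rightarrow> state \<Rightarrow> real \<Rightarrow> state" where
  "wave1 D ul um x =
    (if snd um < snd ul then (if x < \<sigma> ul um then ul else um)
     else if x < lambda1 D ul then ul
     else if x > lambda1 D um then um
     else (THE u. fst u \<in> {fst um..fst ul} \<and> snd u = W D ul - pr D (fst u) \<and> lambda1 D u = x))"

definition R_ARZ :: "model \<Rightarrow> state \<Rightarrow> state \<Rightarrow> real \<Rightarrow> state" where
  "R_ARZ D ul ur x = (if x < snd ur then wave1 D ul (u_mid D ul ur) x else ur)"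

text \<open>
  If \<open>Vc = Vmin\<close> then the two phases meet: they share the state (Rf'', Vmin), or the whole set
  \<open>Omega_f''\<close> when V is constant.  The case distinction of the Riemann solver and the decomposition of
  the constraint set are by phase, and the cases would contradict each other on shared states, so
  shared states are counted as free-flow states there.  For \<open>Vc < Vmin\<close> the phases are disjoint and
  \<open>Omega_c_only D = Omega_c D\<close>.
\<close>

definition Omega_c_only :: "model \<Rightarrow> state set" where
  "Omega_c_only D = Omega_c D - Omega_f D"

definition R_1 :: "model \<Rightarrow> state \<Rightarrow> state \<Rightarrow> real \<Rightarrow> state" where
  "R_1 D ul ur x =
    (if ul \<in> Omega_f D \<and> ur \<in> Omega_f D then R_LWR D ul ur x
     else if ul \<in> Omega_c_only D \<and> ur \<in> Omega_c_only D then R_ARZ D ul ur x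
     else if ul \<in> Omega_f D \<and> ur \<in> Omega_c_only D then
       (let um = u_mid D ul ur in if x < \<sigma> ul um then ul else R_ARZ D um ur x)
     else
       (let uc = u_c D (W D ul); uf = u_f D (W D ul)
        in if x < \<sigma> uc uf then R_ARZ D ul uc x else R_LWR D uf ur x))"

definition trace_left :: "(real \<Rightarrow> state) \<Rightarrow> state" where
  "trace_left f = Lim (at_left 0) f"

definition trace_right :: "(real \<Rightarrow> state) \<Rightarrow> state" where
  "trace_right f = Lim (at_right 0) f"

definition N_1 :: "model \<Rightarrow> (state \<times> state) set" where
  "N_1 D = {(ul, ur) \<in> Omega D \<times> Omega D.
     Q (trace_left (R_1 D ul ur)) > Q0 D \<and> Q (trace_right (R_1 D ul ur)) > Q0 D}"

definition N_ff :: "model \<Rightarrow> (state \<times> state) set" where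
  "N_ff D = Omega_f D \<times> Omega_f D - {(ul, ur). Q ul \<le> Q0 D}"

definition N_cc :: "model \<Rightarrow> (state \<times> state) set" where
  "N_cc D = Omega_c_only D \<times> Omega_c_only D -
     {(ul, ur). pinv D (W D ul - snd ur) * snd ur \<le> Q0 D}"

definition N_cf :: "model \<Rightarrow> (state \<times> state) set" where
  "N_cf D = Omega_c_only D \<times> Omega_f D - {(ul, ur). Q (u_f D (W D ul)) \<le> Q0 D}"

definition N_fc :: "model \<Rightarrow> (state \<times> state) set" where
  "N_fc D = Omega_f D \<times> Omega_c_only D -
     {(ul, ur). min (Q ul) (pinv D (W D ul - snd ur) * snd ur) \<le> Q0 D}"

definition cond_A :: "model \<Rightarrow> state \<Rightarrow> state \<Rightarrow> state \<Rightarrow> state \<Rightarrow> bool" where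
  "cond_A D ul ur uh uk \<longleftrightarrow>
     trace_left (R_1 D ul uh) = uh \<and> trace_right (R_1 D uk ur) = uk \<and>
     Q uh = Q uk \<and> Q uk \<le> Q0 D \<and> W D uh = W D ul"

definition cond_B :: "model \<Rightarrow> state \<Rightarrow> state \<Rightarrow> state \<Rightarrow> state \<Rightarrow> bool" where
  "cond_B D ul ur uh uk \<longleftrightarrow>
     (\<forall>(uh', uk') \<in> Omega D \<times> Omega D - {(uh, uk)}. cond_A D ul ur uh' uk' \<longrightarrow> Q uh' < Q uh)"

definition selected :: "model \<Rightarrow> state \<Rightarrow> state \<Rightarrow> state \<Rightarrow> state \<Rightarrow> bool" where
  "selected D ul ur uh uk \<longleftrightarrow>
     uh \<in> Omega_c D \<and> uk \<in> Omega D \<and> cond_A D ul ur uh uk \<and> cond_B D ul ur uh uk"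

end

theory Submission
  imports Defs
begin

text \<open>
  Fix a marker \<open>w\<close>. The flow along the curve \<open>v = w - p(\<rho>)\<close> is \<open>\<rho> (w - p(\<rho>))\<close>, a strictly
  concave function of the density because \<open>(\<rho> p)'' > 0\<close>. At the free-flow state with marker \<open>w\<close>
  its slope \<open>\<lambda>\<^sub>1 = V - \<rho> p'\<close> is already negative, hence it is negative at all higher densities, in
  particular at every congested state (\<open>marker_speed_neg\<close>). So on the congested part of the curve all
  1-waves move to the left, and the flow increases strictly with the speed. In free flow, on the other
  hand, \<open>V + \<rho> V' > 0\<close>: all waves move to the right, and the flow increases strictly with the density.

  These signs make the profile of \<open>R_1\<close> constant on each side of 0 near 0, so its traces there can be
  written down explicitly (\<open>traces_free_free\<close>, \<open>traces_congested_congested\<close>,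
  \<open>traces_congested_free\<close>, \<open>traces_free_congested\<close>); only the jump from free flow
  to congestion can have a speed of either sign, namely that of the difference in flow. The two trace equations of condition (A) then
  describe two sets, one for each side. With the flow and marker constraints, the left state ranges over
  the congested states with marker \<open>w\<^sub>l\<close> (\<open>left_admissible_iff\<close>). The right state ranges over
  all of free flow if \<open>u\<^sub>r\<close> is free (\<open>right_admissible_free_iff\<close>); if \<open>u\<^sub>r\<close> is congested, it
  ranges over the congested states of speed \<open>v\<^sub>r\<close> together with those states of \<open>Omega_f'\<close> whose
  flow lies below that of the congested state \<open>(Wc, v\<^sub>r)\<close> (\<open>right_admissible_congested_iff\<close>).

  On both sets the flow is injective, so a pair satisfying (A) is determined by the common value of its
  flow, and condition (B) asks for the largest value that is attained. If \<open>u\<^sub>r\<close> is free, this is the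
  minimum of \<open>Q0\<close> and the maximal congested flow \<open>Q(u_c(w\<^sub>l))\<close>. If \<open>u\<^sub>r\<close> is congested, violation
  of the constraint says that the intermediate state \<open>(w\<^sub>l, v\<^sub>r)\<close> carries more than \<open>Q0\<close>, and so
  \<open>Q0\<close> itself is attained. The intermediate value theorem provides the states.
\<close>

context phase_transition_model
begin

section \<open>Monotonicity of the velocity and pressure laws\<close>

lemma Vel_DERIV:
  assumes "0 < x" "x < Rf'' D"
  shows "(Vel D has_real_derivative Vel' D x) (at x)"
  using Vel_C2(1)[of x] assms at_within_Icc_at[of 0 x "Rf'' D"] by simp

lemma continuous_on_Vel: "continuous_on {0..Rf'' D} (Vel D)"
  using Vel_C2(1) by (rule DERIV_continuous_on)

lemma continuous_on_pr: "continuous_on {0<..} (pr D)"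
proof (rule DERIV_continuous_on)
  show "(pr D has_real_derivative pr' D x) (at x within {0<..})" if "x \<in> {0<..}" for x
    using pr_C2(1)[of x] that by (auto intro: has_field_derivative_at_within)
qed

lemma continuous_on_marker_curve:
  assumes "0 < a"
  shows "continuous_on {a..b} (\<lambda>x. x * (w - pr D x))"
  using assms by (intro continuous_intros continuous_on_subset[OF continuous_on_pr]) auto

lemma Vel_antimono:
  assumes "0 \<le> x" "x \<le> y" "y \<le> Rf'' D"
  shows "Vel D y \<le> Vel D x"
proof (rule DERIV_nonpos_imp_decreasing_open[where f = "Vel D"])
  show "\<exists>d. (Vel D has_real_derivative d) (at z) \<and> d \<le> 0" if "x < z" "z < y" for z
    using Vel_DERIV[of z] Vel_cond(1)[of z] that assms by (intro exI[of _ "Vel' D z"]) auto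
  show "continuous_on {x..y} (Vel D)"
    using continuous_on_subset[OF continuous_on_Vel] assms by auto
qed fact

lemma free_flow_increasing:
  assumes "0 \<le> x" "x < y" "y \<le> Rf'' D"
  shows "x * Vel D x < y * Vel D y"
proof (rule DERIV_pos_imp_increasing_open[where f = "\<lambda>x. x * Vel D x"])
  show "\<exists>d. ((\<lambda>x. x * Vel D x) has_real_derivative d) (at z) \<and> d > 0" if "x < z" "z < y" for z
  proof (intro exI conjI)
    show "((\<lambda>x. x * Vel D x) has_real_derivative Vel D z + z * Vel' D z) (at z)"
      using that assms by (auto intro!: derivative_eq_intros Vel_DERIV)
    show "Vel D z + z * Vel' D z > 0" using Vel_cond(2)[of z] that assms by auto
  qed
  show "continuous_on {x..y} (\<lambda>x. x * Vel D x)"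
    using assms by (intro continuous_intros continuous_on_subset[OF continuous_on_Vel]) auto
qed fact

lemma pr_increasing:
  assumes "0 < x" "x < y"
  shows "pr D x < pr D y"
proof (rule DERIV_pos_imp_increasing[OF assms(2)])
  show "\<exists>d. (pr D has_real_derivative d) (at z) \<and> d > 0" if "x \<le> z" "z \<le> y" for z
    using pr_C2(1)[of z] pr_cond(1)[of z] that assms by (intro exI[of _ "pr' D z"]) auto
qed

lemma pr_less_iff: "0 < x \<Longrightarrow> 0 < y \<Longrightarrow> pr D x < pr D y \<longleftrightarrow> x < y"
  by (metis pr_increasing less_asym less_linear)

lemma free_marker_increasing:
  assumes "Rf' D \<le> x" "x < y" "y \<le> Rf'' D"
  shows "Vel D x + pr D x < Vel D y + pr D y"
proof (rule DERIV_pos_imp_increasing_open[where f = "\<lambda>x. Vel D x + pr D x"])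
  show "\<exists>d. ((\<lambda>x. Vel D x + pr D x) has_real_derivative d) (at z) \<and> d > 0"
    if "x < z" "z < y" for z
    using that assms Rf Vel_pr_cond(1)[of z]
    by (intro exI[of _ "Vel' D z + pr' D z"]) (auto intro!: derivative_eq_intros Vel_DERIV pr_C2(1))
  show "continuous_on {x..y} (\<lambda>x. Vel D x + pr D x)"
    using assms Rf
    by (intro continuous_intros continuous_on_subset[OF continuous_on_Vel]
        continuous_on_subset[OF continuous_on_pr]) auto
qed fact

text \<open>
  Along a curve of constant marker \<open>w\<close> the flow \<open>\<rho> (w - p(\<rho>))\<close> is strictly concave; its derivative
  is the characteristic speed \<open>\<lambda>\<^sub>1\<close>.
\<close>

lemma marker_speed_decreasing:
  assumes "0 < x" "x < y"
  shows "w - pr D y - y * pr' D y < w - pr D x - x * pr' D x"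
proof (rule DERIV_neg_imp_decreasing[OF assms(2)])
  show "\<exists>d. ((\<lambda>x. w - pr D x - x * pr' D x) has_real_derivative d) (at z) \<and> d < 0"
    if "x \<le> z" "z \<le> y" for z
    using that assms pr_cond(2)[of z]
    by (intro exI[of _ "- (2 * pr' D z + z * pr'' D z)"])
      (auto intro!: derivative_eq_intros pr_C2(1,2))
qed

section \<open>Free-flow states and congested states as parameterised by their marker\<close>

abbreviation markers :: "real set" where "markers \<equiv> {Wc D..Wmax D}"

text \<open>
  Since \<open>V + p\<close> is strictly increasing on \<open>[Rf', Rf'']\<close>, a state of \<open>Omega_f''\<close> is
  recovered from its marker; this evaluates the description operator in \<open>u_f\<close>.
\<close>

lemma u_f_unique:
  assumes "Rf' D \<le> x" "x \<le> Rf'' D"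
  shows "u_f D (Vel D x + pr D x) = (x, Vel D x)"
  unfolding u_f_def
proof (rule the_equality)
  show "(x, Vel D x) \<in> Omega_f'' D \<and> snd (x, Vel D x) = Vel D (fst (x, Vel D x)) \<and>
      snd (x, Vel D x) = Vel D x + pr D x - pr D (fst (x, Vel D x))"
    using assms Rf Vel_antimono[of 0 x] Vel_antimono[of x "Rf'' D"]
    by (auto simp: Omega_f''_def Omega_f_def Vmin_def Vmax_def)
  fix u
  assume u: "u \<in> Omega_f'' D \<and> snd u = Vel D (fst u) \<and> snd u = Vel D x + pr D x - pr D (fst u)"
  then have "Rf' D \<le> fst u" "fst u \<le> Rf'' D" "Vel D (fst u) + pr D (fst u) = Vel D x + pr D x"
    by (auto simp: Omega_f''_def Omega_f_def)
  then have "fst u = x"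
    using free_marker_increasing[of x "fst u"] free_marker_increasing[of "fst u" x] assms
    by (cases "fst u" x rule: linorder_cases) auto
  with u show "u = (x, Vel D x)" by (cases u) auto
qed

lemma u_f_props:
  assumes "w \<in> markers"
  shows "Rf' D \<le> fst (u_f D w)" "fst (u_f D w) \<le> Rf'' D"
    and "snd (u_f D w) = Vel D (fst (u_f D w))"
    and "Vel D (fst (u_f D w)) + pr D (fst (u_f D w)) = w"
proof -
  have "\<exists>x. Rf' D \<le> x \<and> x \<le> Rf'' D \<and> Vel D x + pr D x = w"
  proof (rule IVT')
    show "continuous_on {Rf' D..Rf'' D} (\<lambda>x. Vel D x + pr D x)"
      using Rf by (intro continuous_intros continuous_on_subset[OF continuous_on_Vel]
        continuous_on_subset[OF continuous_on_pr]) auto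
  qed (use assms Rf in \<open>auto simp: Wc_def Wmax_def Vmin_def\<close>)
  then obtain x where "Rf' D \<le> x" "x \<le> Rf'' D" "Vel D x + pr D x = w" by blast
  then show "Rf' D \<le> fst (u_f D w)" "fst (u_f D w) \<le> Rf'' D"
    "snd (u_f D w) = Vel D (fst (u_f D w))" "Vel D (fst (u_f D w)) + pr D (fst (u_f D w)) = w"
    using u_f_unique[of x] by auto
qed

lemma Omega_f_iff: "u \<in> Omega_f D \<longleftrightarrow> 0 \<le> fst u \<and> fst u \<le> Rf'' D \<and> snd u = Vel D (fst u)"
  using Rf Vel_antimono[of 0 "fst u"] Vel_antimono[of "fst u" "Rf'' D"]
  by (cases u) (auto simp: Omega_f_def Vmin_def Vmax_def)

lemma Omega_f_cases:
  assumes "u \<in> Omega_f D"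
  obtains "u \<in> Omega_f' D" | "u \<in> Omega_f'' D"
  using assms by (cases "fst u < Rf' D") (auto simp: Omega_f'_def Omega_f''_def)

lemma Wc_le_Wmax: "Wc D \<le> Wmax D"
  using free_marker_increasing[of "Rf' D" "Rf'' D"] Rf by (auto simp: Wc_def Wmax_def Vmin_def)

lemma Omega_f'_W: "u \<in> Omega_f' D \<Longrightarrow> W D u = Wc D"
  by (auto simp: W_def Omega_f'_def Omega_f''_def Omega_c_def split: prod.splits)

lemma Omega_f''_W:
  assumes "u \<in> Omega_f'' D"
  shows "W D u \<in> markers" "u_f D (W D u) = u"
proof -
  from assms have u: "Rf' D \<le> fst u" "fst u \<le> Rf'' D" "snd u = Vel D (fst u)"
    by (auto simp: Omega_f''_def Omega_f_iff)
  have w: "W D u = Vel D (fst u) + pr D (fst u)" using assms u by (simp add: W_def)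
  show "W D u \<in> markers"
    using u free_marker_increasing[of "Rf' D" "fst u"] free_marker_increasing[of "fst u" "Rf'' D"]
    by (cases "fst u = Rf' D"; cases "fst u = Rf'' D")
      (auto simp: w Wc_def Wmax_def Vmin_def)
  show "u_f D (W D u) = u" using u u_f_unique[of "fst u"] by (simp add: w prod_eq_iff)
qed

lemma u_f_Wc: "u_f D (Wc D) = (Rf' D, Vel D (Rf' D))"
  using u_f_unique[of "Rf' D"] Rf by (simp add: Wc_def add.commute)

text \<open>
  All states of \<open>Omega_f'\<close> carry the marker \<open>Wc\<close> by convention, and \<open>u_f Wc\<close> is the state of
  density \<open>Rf'\<close>, which is the upper end of \<open>Omega_f'\<close>.
\<close>

lemma Q_le_Q_u_f:
  assumes "u \<in> Omega_f D"
  shows "Q u \<le> Q (u_f D (W D u))"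
  using assms
proof (cases rule: Omega_f_cases)
  case 1
  then show ?thesis
    using free_flow_increasing[of "fst u" "Rf' D"] Rf
    by (auto simp: Omega_f'_W u_f_Wc Q_def Omega_f'_def Omega_f_iff)
next
  case 2
  then show ?thesis by (simp add: Omega_f''_W)
qed

text \<open>
  On the part of a marker curve beyond free flow the speed \<open>\<lambda>\<^sub>1\<close> is negative: at the free-flow
  state itself this is the hypothesis \<open>V(\<rho>) < \<rho> p'(\<rho>)\<close>, and concavity propagates it to higher densities.
\<close>

lemma marker_speed_neg:
  assumes "w \<in> markers" "fst (u_f D w) \<le> x"
  shows "w - pr D x - x * pr' D x < 0"
proof -
  let ?r = "fst (u_f D w)"
  have r: "0 < ?r" "w - pr D ?r - ?r * pr' D ?r < 0"
    using u_f_props[OF assms(1)] Rf Vel_pr_cond(2)[of ?r] by auto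
  then show ?thesis
    using marker_speed_decreasing[of ?r x w] assms(2) by (cases "?r = x") auto
qed

lemma marker_flow_DERIV:
  "0 < x \<Longrightarrow> ((\<lambda>x. x * (w - pr D x)) has_real_derivative w - pr D x - x * pr' D x) (at x)"
  by (auto intro!: derivative_eq_intros pr_C2(1))

lemma marker_flow_decreasing:
  assumes "w \<in> markers" "fst (u_f D w) \<le> x" "x < y"
  shows "y * (w - pr D y) < x * (w - pr D x)"
proof (rule DERIV_neg_imp_decreasing[OF assms(3)])
  show "\<exists>d. ((\<lambda>x. x * (w - pr D x)) has_real_derivative d) (at z) \<and> d < 0"
    if "x \<le> z" "z \<le> y" for z
    using marker_flow_DERIV[of z w] marker_speed_neg[of w z] that assms u_f_props[of w] Rf
    by (intro exI[of _ "w - pr D z - z * pr' D z"]) auto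
qed

text \<open>
  The pressure may be bounded, but it does reach \<open>Wmax\<close>: the flow along the curve of marker \<open>Wmax\<close>
  has slope at most \<open>V - \<rho> p' < 0\<close> beyond \<open>Rf''\<close>, so it falls to zero at a finite density.
\<close>

lemma pr_attains_Wmax: "\<exists>x \<ge> Rf'' D. pr D x = Wmax D"
proof -
  define c where "c = Rf'' D * pr' D (Rf'' D) - Vel D (Rf'' D)"
  have c: "c > 0" using Vel_pr_cond(2)[of "Rf'' D"] Rf by (simp add: c_def)
  define h where "h x = x * (Wmax D - pr D x)" for x
  \<comment> \<open>The tangent of \<open>h\<close> at \<open>Rf''\<close>, which lies above \<open>h\<close>, vanishes at \<open>b\<close>.\<close>
  define b where "b = Rf'' D + h (Rf'' D) / c"
  have hG: "h (Rf'' D) > 0" using Rf Vel_pos by (simp add: h_def Wmax_def Vmin_def)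
  have b: "Rf'' D < b" using hG c by (simp add: b_def)
  have "h b + c * b \<le> h (Rf'' D) + c * Rf'' D"
  proof (rule DERIV_nonpos_imp_nonincreasing[where f = "\<lambda>x. h x + c * x"])
    fix z assume z: "Rf'' D \<le> z" "z \<le> b"
    have "Wmax D - pr D z - z * pr' D z \<le> Wmax D - pr D (Rf'' D) - Rf'' D * pr' D (Rf'' D)"
      using marker_speed_decreasing[of "Rf'' D" z "Wmax D"] z Rf by (cases "z = Rf'' D") auto
    also have "\<dots> = - c" by (simp add: c_def Wmax_def Vmin_def)
    finally show "\<exists>y. ((\<lambda>x. h x + c * x) has_real_derivative y) (at z) \<and> y \<le> 0"
      using z Rf unfolding h_def
      by (intro exI[of _ "(Wmax D - pr D z - z * pr' D z) + c"] conjI)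
        (auto intro!: DERIV_add marker_flow_DERIV derivative_eq_intros)
  qed (use b in simp)
  moreover have "c * b = c * Rf'' D + h (Rf'' D)" using c by (simp add: b_def distrib_left)
  ultimately have "h b \<le> 0" by simp
  then have "Wmax D \<le> pr D b" using b Rf by (auto simp: h_def mult_le_0_iff)
  moreover have "pr D (Rf'' D) \<le> Wmax D" using Vel_pos by (simp add: Wmax_def Vmin_def)
  moreover have "continuous_on {Rf'' D..b} (pr D)"
    using Rf by (intro continuous_on_subset[OF continuous_on_pr]) auto
  ultimately show ?thesis
    using IVT'[of "pr D" "Rf'' D" "Wmax D" b] b by auto
qed

lemma pinv_pr: "0 < x \<Longrightarrow> pinv D (pr D x) = x"
  unfolding pinv_def
  by (rule the_inv_into_f_f) (auto intro!: linorder_inj_onI' simp: pr_less_iff dest: pr_increasing)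

lemma pinv_props:
  assumes "pr D (Rf' D) \<le> y" "y \<le> Wmax D"
  shows "Rf' D \<le> pinv D y" "pr D (pinv D y) = y"
proof -
  obtain b where b: "Rf'' D \<le> b" "pr D b = Wmax D" using pr_attains_Wmax by blast
  have "continuous_on {Rf' D..b} (pr D)"
    using Rf by (intro continuous_on_subset[OF continuous_on_pr]) auto
  then obtain x where "Rf' D \<le> x" "pr D x = y"
    using IVT'[of "pr D" "Rf' D" y b] b assms Rf by auto
  then show "Rf' D \<le> pinv D y" "pr D (pinv D y) = y" using pinv_pr[of x] Rf by auto
qed

lemma pinv_mono:
  assumes "pr D (Rf' D) \<le> y" "y \<le> z" "z \<le> Wmax D"
  shows "pinv D y \<le> pinv D z"
proof (rule ccontr)
  assume "\<not> pinv D y \<le> pinv D z"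
  then have "pr D (pinv D z) < pr D (pinv D y)"
    using pinv_props[of z] assms Rf by (intro pr_increasing) auto
  then show False using pinv_props[of y] pinv_props[of z] assms by auto
qed

text \<open>
  A congested state is parameterised by its marker and its speed: \<open>Omega_c\<close> consists exactly of
  the states \<open>congested w v\<close> with \<open>Wc \<le> w \<le> Wmax\<close> and \<open>0 \<le> v \<le> Vc\<close>.
  Both \<open>u_mid\<close> and \<open>u_c\<close> are of this form.
\<close>

abbreviation congested :: "real \<Rightarrow> real \<Rightarrow> state" where
  "congested w v \<equiv> (pinv D (w - v), v)"

lemma u_mid_eq: "u_mid D ul ur = congested (W D ul) (snd ur)"
  by (simp add: u_mid_def)

lemma u_c_eq: "u_c D w = congested w (Vc D)"
  by (simp add: u_c_def)

lemma Vc_le_Vel: "0 \<le> x \<Longrightarrow> x \<le> Rf'' D \<Longrightarrow> Vc D \<le> Vel D x"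
  using Vel_antimono[of x "Rf'' D"] Vc by (simp add: Vmin_def)

lemma congested_props:
  assumes "w \<in> markers" "v \<in> {0..Vc D}"
  shows "Rf' D \<le> pinv D (w - v)" "pr D (pinv D (w - v)) = w - v"
    and "congested w v \<in> Omega_c D" "W D (congested w v) = w"
    and "fst (u_f D w) \<le> pinv D (w - v)"
proof -
  \<comment> \<open>The lower bound is \<open>w - v \<ge> Wc - Vc\<close> together with \<open>Vc \<le> V(Rf')\<close>.\<close>
  have bounds: "pr D (Rf' D) \<le> w - v" "w - v \<le> Wmax D"
    using assms Vc_le_Vel[of "Rf' D"] Rf by (auto simp: Wc_def)
  show 1: "Rf' D \<le> pinv D (w - v)" "pr D (pinv D (w - v)) = w - v"
    using pinv_props[OF bounds] by auto
  show 2: "congested w v \<in> Omega_c D"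
    using 1 assms pinv_mono[OF bounds(1) bounds(2)] by (auto simp: Omega_c_def Rmax_def)
  show "W D (congested w v) = w" using 1 2 by (simp add: W_def)
  let ?r = "fst (u_f D w)"
  have "pr D ?r \<le> w - v"
    using u_f_props[OF assms(1)] Vc_le_Vel[of ?r] assms(2) Rf by auto
  then show "?r \<le> pinv D (w - v)"
    using 1 Rf u_f_props(1)[OF assms(1)] pr_less_iff[of "pinv D (w - v)" ?r] by auto
qed

lemma Omega_c_props:
  assumes "u \<in> Omega_c D"
  shows "W D u \<in> markers" "snd u \<in> {0..Vc D}" "congested (W D u) (snd u) = u"
  using assms Rf pinv_pr[of "fst u"] by (auto simp: W_def Omega_c_def split: prod.splits)

lemma congested_density_strict_antimono:
  assumes "w \<in> markers" "0 \<le> v" "v < v'" "v' \<le> Vc D"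
  shows "pinv D (w - v') < pinv D (w - v)"
  using congested_props[of w v] congested_props[of w v'] assms Rf
    pr_less_iff[of "pinv D (w - v')" "pinv D (w - v)"] by auto

lemma Q_congested_strict_mono:
  assumes "w \<in> markers" "0 \<le> v" "v < v'" "v' \<le> Vc D"
  shows "Q (congested w v) < Q (congested w v')"
  using congested_density_strict_antimono[OF assms] marker_flow_decreasing[of w "pinv D (w - v')" "pinv D (w - v)"] assms
      congested_props[of w v] congested_props[of w v'] by (simp add: Q_def)

lemma Q_congested_mono:
  assumes "w \<in> markers" "0 \<le> v" "v \<le> v'" "v' \<le> Vc D"
  shows "Q (congested w v) \<le> Q (congested w v')"
  using Q_congested_strict_mono[of w v v'] assms by (cases "v = v'") auto

text \<open>A congested state is denser and carries less flow than the free-flow state with its marker, unless the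
  two phases meet there.\<close>

lemma Q_congested_less_Q_u_f:
  assumes "w \<in> markers" "v \<in> {0..Vc D}" "congested w v \<noteq> u_f D w"
  shows "fst (u_f D w) < pinv D (w - v)" "Q (congested w v) < Q (u_f D w)"
proof -
  note c = congested_props[OF assms(1,2)] and f = u_f_props[OF assms(1)]
  have "fst (u_f D w) \<noteq> pinv D (w - v)"
    using c f assms(3) by (auto simp: prod_eq_iff)
  then show *: "fst (u_f D w) < pinv D (w - v)" using c by simp
  have "snd (u_f D w) = w - pr D (fst (u_f D w))" using f by simp
  then show "Q (congested w v) < Q (u_f D w)"
    using marker_flow_decreasing[OF assms(1) _ *] c by (simp add: Q_def)
qed

text \<open>
  The flow is continuous in the density along a marker curve, and vanishes at its end \<open>v = 0\<close>.
\<close>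

lemma congested_flow_attained:
  assumes "w \<in> markers" "0 \<le> q" "q \<le> Q (congested w (Vc D))"
  shows "\<exists>v \<in> {0..Vc D}. Q (congested w v) = q"
proof -
  let ?a = "pinv D (w - Vc D)" and ?b = "pinv D (w - 0)"
  note a = congested_props[of w "Vc D"] and b = congested_props[of w 0]
  have ab: "?a \<le> ?b"
    using pinv_mono[of "w - Vc D" w] assms Vc Vc_le_Vel[of "Rf' D"] Rf by (auto simp: Wc_def)
  have "\<exists>x. ?a \<le> x \<and> x \<le> ?b \<and> x * (w - pr D x) = q"
    by (rule IVT2') (use a b ab assms Vc Rf continuous_on_marker_curve[of ?a ?b] in \<open>auto simp: Q_def\<close>)
  then obtain x where x: "?a \<le> x" "x \<le> ?b" "x * (w - pr D x) = q" by blast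
  have "0 < ?a" using a assms Vc Rf by auto
  then have "pr D ?a \<le> pr D x" "pr D x \<le> pr D ?b"
    using x pr_increasing[of ?a x] pr_increasing[of x ?b] by (auto simp: le_less)
  then have "w - pr D x \<in> {0..Vc D}" using a b assms Vc by auto
  moreover have "congested w (w - pr D x) = (x, w - pr D x)"
    using pinv_pr[of x] x \<open>0 < ?a\<close> by simp
  ultimately show ?thesis using x by (intro bexI[of _ "w - pr D x"]) (auto simp: Q_def)
qed

lemma free_flow_attained:
  assumes "0 \<le> q" "q \<le> x * Vel D x" "0 \<le> x" "x \<le> Rf'' D"
  shows "\<exists>u \<in> Omega_f D. fst u \<le> x \<and> Q u = q"
proof -
  have "\<exists>y. 0 \<le> y \<and> y \<le> x \<and> y * Vel D y = q"
    by (rule IVT')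
      (use assms in \<open>auto intro!: continuous_intros continuous_on_subset[OF continuous_on_Vel]\<close>)
  then obtain y where "0 \<le> y" "y \<le> x" "y * Vel D y = q" by blast
  then show ?thesis using assms by (intro bexI[of _ "(y, Vel D y)"]) (auto simp: Q_def Omega_f_iff)
qed

lemma Q_inj_on_Omega_f: "inj_on Q (Omega_f D)"
proof (rule inj_onI)
  fix u u' assume u: "u \<in> Omega_f D" "u' \<in> Omega_f D" "Q u = Q u'"
  then have "fst u = fst u'"
    using free_flow_increasing[of "fst u" "fst u'"] free_flow_increasing[of "fst u'" "fst u"]
    by (cases "fst u" "fst u'" rule: linorder_cases) (auto simp: Omega_f_iff Q_def)
  with u show "u = u'" by (auto simp: Omega_f_iff prod_eq_iff)
qed

lemma W_in_markers:
  assumes "u \<in> Omega D"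
  shows "W D u \<in> markers"
proof -
  consider "u \<in> Omega_c D" | "u \<in> Omega_f' D" | "u \<in> Omega_f'' D"
    using assms by (auto simp: Omega_def elim: Omega_f_cases)
  then show ?thesis
    by cases (use Omega_f'_W Omega_f''_W(1) Omega_c_props(1) Wc_le_Wmax in auto)
qed

section \<open>Traces of the Riemann solvers\<close>

lemma trace_left_eqI:
  assumes "eventually (\<lambda>x. x < 0 \<longrightarrow> f x = l) (nhds 0)"
  shows "trace_left f = l"
  unfolding trace_left_def
  by (rule tendsto_Lim, simp, rule tendsto_eventually)
    (use assms in \<open>auto simp: eventually_at_filter elim: eventually_mono\<close>)

lemma trace_right_eqI:
  assumes "eventually (\<lambda>x. 0 < x \<longrightarrow> f x = l) (nhds 0)"
  shows "trace_right f = l"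
  unfolding trace_right_def
  by (rule tendsto_Lim, simp, rule tendsto_eventually)
    (use assms in \<open>auto simp: eventually_at_filter elim: eventually_mono\<close>)

lemma eventually_less_near_0: "0 < c \<Longrightarrow> eventually (\<lambda>x. x < c) (nhds (0::real))"
  by (rule order_tendstoD[OF filterlim_ident])

lemma eventually_greater_near_0: "c < 0 \<Longrightarrow> eventually (\<lambda>x. c < x) (nhds (0::real))"
  by (rule order_tendstoD[OF filterlim_ident])

text \<open>
  Every wave of the scalar model has positive speed: a shock because the flow increases with the density,
  a rarefaction because its speeds are values of \<open>V + \<rho> V'\<close>.
\<close>

lemma R_LWR_near_0:
  assumes "ul \<in> Omega_f D" "ur \<in> Omega_f D"
  shows "eventually (\<lambda>x. R_LWR D ul ur x = ul) (nhds 0)"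
proof (cases "fst ul < fst ur")
  case True
  then have "0 < \<sigma> ul ur"
    using assms free_flow_increasing[of "fst ul" "fst ur"]
    by (auto simp: \<sigma>_def Q_def Omega_f_iff)
  from eventually_less_near_0[OF this] show ?thesis
    by (rule eventually_mono) (simp add: R_LWR_def True)
next
  case False
  have "0 < Vel D (fst ul) + fst ul * Vel' D (fst ul)"
    using assms Vel_cond(2)[of "fst ul"] by (simp add: Omega_f_iff)
  from eventually_less_near_0[OF this] show ?thesis
    by (rule eventually_mono) (use False in \<open>simp add: R_LWR_def\<close>)
qed

lemma lambda1_congested_neg:
  assumes "w \<in> markers" "v \<in> {0..Vc D}"
  shows "lambda1 D (congested w v) < 0"
  using marker_speed_neg[of w "pinv D (w - v)"] congested_props[OF assms] assms(1)
  by (simp add: lambda1_def)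

text \<open>
  The 1-wave has negative speed, so near 0 only the contact discontinuity may be visible, and only
  if it is stationary, that is if \<open>v\<^sub>r = 0\<close>.
\<close>

lemma R_ARZ_near_0:
  assumes "ul \<in> Omega_c D" "ur \<in> Omega_c D"
  shows "eventually (\<lambda>x. R_ARZ D ul ur x = (if x < snd ur then u_mid D ul ur else ur)) (nhds 0)"
proof -
  let ?w = "W D ul" and ?um = "u_mid D ul ur"
  note l = Omega_c_props[OF assms(1)] and r = Omega_c_props[OF assms(2)]
  have "eventually (\<lambda>x. wave1 D ul ?um x = ?um) (nhds 0)"
  proof (cases "snd ur < snd ul")
    case True
    then have "Q ?um < Q ul" "fst ul < fst ?um"
      using Q_congested_strict_mono[of ?w "snd ur" "snd ul"]
        congested_density_strict_antimono[of ?w "snd ur" "snd ul"] l r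
      by (auto simp: u_mid_eq prod_eq_iff)
    then have "\<sigma> ul ?um < 0" by (simp add: \<sigma>_def divide_neg_pos)
    from eventually_greater_near_0[OF this] show ?thesis
      by (rule eventually_mono) (use True in \<open>simp add: wave1_def u_mid_eq\<close>)
  next
    case False
    have "lambda1 D ul < 0" "lambda1 D ?um < 0"
      using lambda1_congested_neg[of ?w "snd ul"] lambda1_congested_neg[of ?w "snd ur"] l r
      by (auto simp: u_mid_eq)
    from this[THEN eventually_greater_near_0] show ?thesis
      by eventually_elim (use False in \<open>simp add: wave1_def u_mid_eq\<close>)
  qed
  then show ?thesis by eventually_elim (simp add: R_ARZ_def)
qed

lemma Omega_c_only_iff: "u \<in> Omega_c_only D \<longleftrightarrow> u \<in> Omega_c D \<and> u \<notin> Omega_f D"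
  by (simp add: Omega_c_only_def)

lemma traces_free_free:
  assumes "ul \<in> Omega_f D" "ur \<in> Omega_f D"
  shows "trace_left (R_1 D ul ur) = ul" "trace_right (R_1 D ul ur) = ul"
  using R_LWR_near_0[OF assms] assms
  by (auto intro!: trace_left_eqI trace_right_eqI simp: R_1_def elim: eventually_mono)

lemma traces_congested_congested:
  assumes "ul \<in> Omega_c_only D" "ur \<in> Omega_c_only D"
  shows "trace_left (R_1 D ul ur) = congested (W D ul) (snd ur)"
    and "trace_right (R_1 D ul ur) = (if 0 < snd ur then congested (W D ul) (snd ur) else ur)"
proof -
  have R: "R_1 D ul ur = R_ARZ D ul ur"
    using assms by (auto simp: R_1_def Omega_c_only_iff)
  have c: "ul \<in> Omega_c D" "ur \<in> Omega_c D" using assms by (auto simp: Omega_c_only_iff)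
  have v: "0 \<le> snd ur" using Omega_c_props[OF c(2)] by simp
  note near = R_ARZ_near_0[OF c]
  show "trace_left (R_1 D ul ur) = congested (W D ul) (snd ur)"
    unfolding R
    by (rule trace_left_eqI, rule eventually_mono[OF near]) (use v in \<open>auto simp: u_mid_eq\<close>)
  show "trace_right (R_1 D ul ur) = (if 0 < snd ur then congested (W D ul) (snd ur) else ur)"
  proof (cases "0 < snd ur")
    case True
    have "trace_right (R_ARZ D ul ur) = congested (W D ul) (snd ur)"
      using near eventually_less_near_0[OF True]
      by (intro trace_right_eqI, eventually_elim) (simp add: u_mid_eq)
    then show ?thesis using True by (simp add: R)
  next
    case False
    have "trace_right (R_ARZ D ul ur) = ur"
      by (rule trace_right_eqI, rule eventually_mono[OF near]) (use v False in auto)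
    then show ?thesis using False by (simp add: R)
  qed
qed

lemma u_f_in_Omega_f: "w \<in> markers \<Longrightarrow> u_f D w \<in> Omega_f D"
  using u_f_props[of w] Rf by (auto simp: Omega_f_iff)

text \<open>
  The phase transition from \<open>u_c\<close> to \<open>u_f\<close> joins a state to one of lower density and higher flow,
  hence moves to the left.
\<close>

lemma traces_congested_free:
  assumes "ul \<in> Omega_c_only D" "ur \<in> Omega_f D"
  shows "trace_left (R_1 D ul ur) = u_f D (W D ul)" "trace_right (R_1 D ul ur) = u_f D (W D ul)"
proof -
  let ?w = "W D ul"
  let ?uc = "u_c D ?w" and ?uf = "u_f D ?w"
  have ul: "ul \<in> Omega_c D" "ul \<notin> Omega_f D" using assms by (auto simp: Omega_c_only_iff)
  have w: "?w \<in> markers" using Omega_c_props[OF ul(1)] by simp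
  have Vc': "Vc D \<in> {0..Vc D}" using Vc by simp
  have uc: "?uc \<in> Omega_c D" "u_mid D ul ?uc = ?uc"
    using congested_props[OF w Vc'] by (auto simp: u_c_eq u_mid_eq)
  have arz: "eventually (\<lambda>x. R_ARZ D ul ?uc x = ?uc) (nhds 0)"
    using R_ARZ_near_0[OF ul(1) uc(1)] by eventually_elim (simp add: uc)
  have lwr: "eventually (\<lambda>x. R_LWR D ?uf ur x = ?uf) (nhds 0)"
    using R_LWR_near_0[OF u_f_in_Omega_f[OF w] assms(2)] .
  have R: "R_1 D ul ur x =
      (if x < \<sigma> ?uc ?uf then R_ARZ D ul ?uc x else R_LWR D ?uf ur x)" for x
    using assms ul by (auto simp: R_1_def Let_def Omega_c_only_iff)
  have "eventually (\<lambda>x. R_1 D ul ur x = ?uf) (nhds 0)"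
  proof (cases "?uc = ?uf")
    \<comment> \<open>The phases touch: \<open>\<sigma>\<close> is \<open>0/0 = 0\<close>, and both formulas give the same state.\<close>
    case True
    from arz lwr show ?thesis by eventually_elim (simp add: R True)
  next
    case False
    then have "\<sigma> ?uc ?uf < 0"
      using Q_congested_less_Q_u_f[OF w Vc'] by (simp add: \<sigma>_def u_c_eq divide_pos_neg)
    from lwr eventually_greater_near_0[OF this] show ?thesis by eventually_elim (simp add: R)
  qed
  then show "trace_left (R_1 D ul ur) = ?uf" "trace_right (R_1 D ul ur) = ?uf"
    by (auto intro!: trace_left_eqI trace_right_eqI elim: eventually_mono)
qed

text \<open>
  A free-flow state has lower density than the congested states it can be joined to, unless it coincides
  with them, so the speed of the phase transition has the sign of the jump in flow.
\<close>

lemma free_le_congested_density: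
  assumes "ul \<in> Omega_f D" "v \<in> {0..Vc D}"
  shows "ul = congested (W D ul) v \<or> fst ul < pinv D (W D ul - v)"
  using assms(1)
proof (cases rule: Omega_f_cases)
  case 1
  then show ?thesis
    using congested_props(1)[of "Wc D" v] assms(2) Wc_le_Wmax by (auto simp: Omega_f'_W Omega_f'_def)
next
  case 2
  then show ?thesis
    using Q_congested_less_Q_u_f(1)[of "W D ul" v] Omega_f''_W[OF 2] assms(2) by metis
qed

lemma traces_free_congested:
  assumes "ul \<in> Omega_f D" "ur \<in> Omega_c_only D"
  defines "um \<equiv> congested (W D ul) (snd ur)"
  shows "trace_left (R_1 D ul ur) = (if Q ul \<le> Q um then ul else um)"
    and "trace_right (R_1 D ul ur) = (if Q ul < Q um then ul else if 0 < snd ur then um else ur)"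
proof -
  have ur: "ur \<in> Omega_c D" "ur \<notin> Omega_f D" using assms by (auto simp: Omega_c_only_iff)
  have v: "snd ur \<in> {0..Vc D}" using Omega_c_props[OF ur(1)] by simp
  have w: "W D ul \<in> markers" using W_in_markers[of ul] assms by (simp add: Omega_def)
  have um: "um \<in> Omega_c D" "W D um = W D ul"
    using congested_props[OF w v] by (auto simp: um_def)
  then have "u_mid D um ur = um" by (simp add: u_mid_eq um_def)
  then have arz: "eventually (\<lambda>x. R_ARZ D um ur x = (if x < snd ur then um else ur)) (nhds 0)"
    using R_ARZ_near_0[OF um(1) ur(1)] by metis
  have R: "R_1 D ul ur x = (if x < \<sigma> ul um then ul else R_ARZ D um ur x)" for x
    using assms ur by (auto simp: R_1_def Let_def u_mid_eq Omega_c_only_iff)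
  \<comment> \<open>If \<open>ul = um\<close> then \<open>\<sigma>\<close> is \<open>0/0 = 0\<close>, in accordance with the equality of the flows.\<close>
  have "ul = um \<or> fst ul < fst um"
    using free_le_congested_density[OF assms(1) v] by (simp add: um_def)
  then have sign: "0 < \<sigma> ul um \<longleftrightarrow> Q ul < Q um" "\<sigma> ul um < 0 \<longleftrightarrow> Q um < Q ul"
    by (auto simp: \<sigma>_def zero_less_divide_iff divide_less_0_iff)
  show "trace_left (R_1 D ul ur) = (if Q ul \<le> Q um then ul else um)"
  proof (cases "Q ul \<le> Q um")
    case True
    then have "0 \<le> \<sigma> ul um" using sign by linarith
    then have "trace_left (R_1 D ul ur) = ul" by (intro trace_left_eqI always_eventually) (simp add: R)
    with True show ?thesis by simp
  next
    case False
    then have "\<sigma> ul um < 0" using sign by simp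
    from arz eventually_greater_near_0[OF this] have "trace_left (R_1 D ul ur) = um"
      by (intro trace_left_eqI, eventually_elim) (use v in \<open>auto simp: R\<close>)
    with False show ?thesis by simp
  qed
  show "trace_right (R_1 D ul ur) = (if Q ul < Q um then ul else if 0 < snd ur then um else ur)"
  proof (cases "Q ul < Q um")
    case True
    then have "0 < \<sigma> ul um" using sign by simp
    from eventually_less_near_0[OF this] have "trace_right (R_1 D ul ur) = ul"
      by (intro trace_right_eqI, eventually_elim) (simp add: R)
    with True show ?thesis by simp
  next
    case False
    then have s: "\<sigma> ul um \<le> 0" using sign by linarith
    show ?thesis
    proof (cases "0 < snd ur")
      case True
      from arz eventually_less_near_0[OF True] have "trace_right (R_1 D ul ur) = um"
        by (intro trace_right_eqI, eventually_elim) (use s in \<open>auto simp: R\<close>)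
      with False True show ?thesis by simp
    next
      case v_r: False
      from arz have "trace_right (R_1 D ul ur) = ur"
        by (intro trace_right_eqI, eventually_elim) (use s v_r v in \<open>auto simp: R\<close>)
      with False v_r show ?thesis by simp
    qed
  qed
qed

section \<open>The states that can stand on either side of the constraint\<close>

lemma Omega_cases:
  assumes "u \<in> Omega D"
  obtains "u \<in> Omega_f D" | "u \<in> Omega_c_only D"
  using assms by (auto simp: Omega_def Omega_c_only_iff)

text \<open>
  Each bound comes from comparing a flow with one of the two traces, which exceed \<open>Q0\<close>: a free left
  state carries at least the flow of the left trace, and the free-flow state of marker \<open>w\<^sub>l\<close> carries
  no less. For congested \<open>u\<^sub>r\<close> the value \<open>v\<^sub>r = 0\<close> is impossible, as one of the
  traces would have zero flow.
\<close>

lemma N_1_D: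
  assumes "(ul, ur) \<in> N_1 D"
  shows "ul \<in> Omega D" "ur \<in> Omega D"
    and "ul \<in> Omega_f D \<Longrightarrow> Q0 D < Q ul"
    and "Q0 D < Q (u_f D (W D ul))"
    and "ur \<in> Omega_c_only D \<Longrightarrow> 0 < snd ur"
    and "ur \<in> Omega_c_only D \<Longrightarrow> Q0 D < Q (congested (W D ul) (snd ur))"
proof -
  from assms show ul: "ul \<in> Omega D" and ur: "ur \<in> Omega D" by (auto simp: N_1_def)
  have trace: "Q0 D < Q (trace_left (R_1 D ul ur))" "Q0 D < Q (trace_right (R_1 D ul ur))"
    using assms by (auto simp: N_1_def)
  have w: "W D ul \<in> markers" using W_in_markers[OF ul] .
  let ?um = "congested (W D ul) (snd ur)"
  have um: "(ul \<in> Omega_f D \<longrightarrow> Q0 D < Q ul) \<and> 0 < snd ur \<and> Q0 D < Q ?um" if c: "ur \<in> Omega_c_only D"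
    using ul
  proof (cases rule: Omega_cases)
    case 1
    have "0 < snd ur \<and> Q0 D < Q ?um"
    proof -
      have "0 \<le> snd ur" using Omega_c_props(2)[of ur] c by (auto simp: Omega_c_only_iff)
      then show ?thesis
        using trace traces_free_congested[OF 1 c] Q0(1)
        by (cases "snd ur = 0"; cases "Q ul \<le> Q ?um") (auto simp: Q_def split: if_splits)
    qed
    moreover have "Q0 D < Q ul"
      using trace traces_free_congested[OF 1 c] by (auto split: if_splits)
    ultimately show ?thesis by simp
  next
    case 2
    have "0 \<le> snd ur" using Omega_c_props(2)[of ur] c by (auto simp: Omega_c_only_iff)
    moreover have "snd ur \<noteq> 0"
      using trace(1) traces_congested_congested[OF 2 c] Q0(1) by (auto simp: Q_def)
    ultimately show ?thesis
      using trace(1) traces_congested_congested[OF 2 c] 2 by (auto simp: Omega_c_only_iff)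
  qed
  from um show "ur \<in> Omega_c_only D \<Longrightarrow> 0 < snd ur"
    "ur \<in> Omega_c_only D \<Longrightarrow> Q0 D < Q ?um" by auto
  show free: "Q0 D < Q ul" if "ul \<in> Omega_f D"
    using ur
  proof (cases rule: Omega_cases)
    case 1
    then show ?thesis using trace traces_free_free[OF that] by simp
  next
    case 2
    then show ?thesis using um that by simp
  qed
  show "Q0 D < Q (u_f D (W D ul))"
    using ul
  proof (cases rule: Omega_cases)
    case 1
    then show ?thesis using free Q_le_Q_u_f[OF 1] by simp
  next
    case ul_c: 2
    show ?thesis
      using ur
    proof (cases rule: Omega_cases)
      case 1
      then show ?thesis using trace traces_congested_free[OF ul_c] by simp
    next
      case 2
      then have "snd ur \<in> {0..Vc D}" using Omega_c_props(2)[of ur] by (auto simp: Omega_c_only_iff)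
      then show ?thesis using um[OF 2] Q_congested_less_Q_u_f(2)[OF w, of "snd ur"] by fastforce
    qed
  qed
qed

lemma shared_state_eq_u_f:
  assumes "u \<in> Omega_f D" "u \<in> Omega_c D"
  shows "u = u_f D (W D u)"
proof -
  have "u \<in> Omega_f'' D" using assms by (auto simp: Omega_f''_def Omega_c_def)
  then show ?thesis by (simp add: Omega_f''_W)
qed

text \<open>
  A free-flow state cannot stand on the left of the constraint. Its trace condition would force it to
  be \<open>u\<^sub>l\<close> itself, or the free-flow state to which \<open>u\<^sub>l\<close> is released, and both carry more than
  \<open>Q0\<close>. A congested state with the marker of \<open>u\<^sub>l\<close> is reached from \<open>u\<^sub>l\<close> by a single
  wave; if \<open>u\<^sub>l\<close> is free this wave moves to the left because the flow drops across it.
\<close>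

lemma left_admissible_iff:
  assumes ul: "ul \<in> Omega D" and uh: "uh \<in> Omega D" "Q uh \<le> Q0 D"
    and free: "ul \<in> Omega_f D \<Longrightarrow> Q0 D < Q ul" and uf: "Q0 D < Q (u_f D (W D ul))"
  shows "trace_left (R_1 D ul uh) = uh \<and> W D uh = W D ul \<longleftrightarrow> uh \<in> Omega_c D \<and> W D uh = W D ul"
proof (cases "uh \<in> Omega_c_only D")
  case True
  then have c: "uh \<in> Omega_c D" by (simp add: Omega_c_only_iff)
  have eq: "congested (W D ul) (snd uh) = uh" if "W D uh = W D ul"
    using Omega_c_props(3)[OF c] that by simp
  have "trace_left (R_1 D ul uh) = uh" if W: "W D uh = W D ul"
    using ul
  proof (cases rule: Omega_cases)
    case 1
    then show ?thesis
      using traces_free_congested(1)[OF 1 True] free uh(2) by (simp add: eq[OF W])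
  next
    case 2
    then show ?thesis using traces_congested_congested(1)[OF 2 True] by (simp add: eq[OF W])
  qed
  with c show ?thesis by blast
next
  case False
  then have f: "uh \<in> Omega_f D" using uh by (auto elim: Omega_cases)
  have "trace_left (R_1 D ul uh) \<noteq> uh"
    using ul
  proof (cases rule: Omega_cases)
    case 1
    then show ?thesis using traces_free_free(1)[OF 1 f] free uh(2) by auto
  next
    case 2
    then show ?thesis using traces_congested_free(1)[OF 2 f] uf uh(2) by auto
  qed
  moreover have "W D uh \<noteq> W D ul" if "uh \<in> Omega_c D"
    using shared_state_eq_u_f[OF f that] uf uh(2) by auto
  ultimately show ?thesis by blast
qed

lemma right_admissible_free_iff:
  assumes "ur \<in> Omega_f D" "uk \<in> Omega D"
  shows "trace_right (R_1 D uk ur) = uk \<longleftrightarrow> uk \<in> Omega_f D"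
  using assms(2)
proof (cases rule: Omega_cases)
  case 1
  then show ?thesis using traces_free_free(2) assms by simp
next
  case 2
  then have "W D uk \<in> markers" using W_in_markers assms by simp
  then show ?thesis
    using traces_congested_free(2)[OF 2 assms(1)] u_f_in_Omega_f[of "W D uk"] 2
    by (auto simp: Omega_c_only_iff)
qed

text \<open>
  The states that a stationary observer can see on the right when \<open>u\<^sub>r\<close> is congested with speed
  \<open>v > 0\<close>: congested states separated from \<open>u\<^sub>r\<close> by a contact discontinuity alone, and sparse
  free-flow states from which the phase transition moves to the right.
\<close>

definition right_admissible :: "real \<Rightarrow> state set" where
  "right_admissible v =
    {u \<in> Omega_c D. snd u = v} \<union> {u \<in> Omega_f' D. Q u < Q (congested (Wc D) v)}"

lemma right_admissible_congested_iff:
  assumes ur: "ur \<in> Omega_c_only D" "0 < snd ur" and uk: "uk \<in> Omega D"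
  shows "trace_right (R_1 D uk ur) = uk \<longleftrightarrow> uk \<in> right_admissible (snd ur)"
proof -
  let ?um = "congested (W D uk) (snd ur)"
  have v: "snd ur \<in> {0..Vc D}" using Omega_c_props(2)[of ur] ur by (auto simp: Omega_c_only_iff)
  have w: "W D uk \<in> markers" using W_in_markers[OF uk] .
  have um: "?um = uk \<longleftrightarrow> uk \<in> Omega_c D \<and> snd uk = snd ur"
    using congested_props(3)[OF w v] Omega_c_props(3)[of uk] by (metis snd_conv)
  consider "uk \<in> Omega_c_only D" | "uk \<in> Omega_f' D" | "uk \<in> Omega_f'' D"
    using uk by (auto elim: Omega_cases Omega_f_cases)
  then show ?thesis
  proof cases
    case 1
    then have "uk \<notin> Omega_f' D" by (auto simp: Omega_c_only_iff Omega_f'_def)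
    then show ?thesis
      using traces_congested_congested(2)[OF 1 ur(1)] ur(2) um by (simp add: right_admissible_def)
  next
    case 2
    then have f: "uk \<in> Omega_f D" and c: "uk \<notin> Omega_c D"
      by (auto simp: Omega_f'_def Omega_c_def)
    then show ?thesis
      using traces_free_congested(2)[OF f ur(1)] ur(2) um 2
      by (auto simp: right_admissible_def Omega_f'_W)
  next
    case 3
    then have f: "uk \<in> Omega_f D" and c: "uk \<notin> Omega_f' D"
      by (auto simp: Omega_f''_def Omega_f'_def)
    have "Q ?um \<le> Q uk"
      using Q_congested_less_Q_u_f(2)[OF w v] Omega_f''_W(2)[OF 3] by (cases "?um = uk") auto
    then show ?thesis
      using traces_free_congested(2)[OF f ur(1)] ur(2) um c
      by (auto simp: right_admissible_def)
  qed
qed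

text \<open>
  At fixed speed the flow increases with the marker. Hence the two parts of \<open>right_admissible\<close>
  occupy disjoint ranges of flow.
\<close>

lemma Q_congested_ge_Wc:
  assumes "u \<in> Omega_c D"
  shows "Q (congested (Wc D) (snd u)) \<le> Q u"
proof -
  note u = Omega_c_props[OF assms]
  have "pinv D (Wc D - snd u) \<le> pinv D (W D u - snd u)"
    using u Vc_le_Vel[of "Rf' D"] Rf by (intro pinv_mono) (auto simp: Wc_def)
  then have "pinv D (Wc D - snd u) * snd u \<le> pinv D (W D u - snd u) * snd u"
    using u(2) by (intro mult_right_mono) auto
  also have "\<dots> = Q (congested (W D u) (snd u))" by (simp only: Q_def fst_conv snd_conv)
  finally show ?thesis unfolding u(3) by (simp add: Q_def)
qed

lemma Q_inj_on_right_admissible: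
  assumes "0 < v"
  shows "inj_on Q (right_admissible v)"
  unfolding right_admissible_def inj_on_Un
proof (intro conjI)
  show "inj_on Q {u \<in> Omega_c D. snd u = v}"
    using assms by (auto intro!: inj_onI simp: Q_def prod_eq_iff)
  show "inj_on Q {u \<in> Omega_f' D. Q u < Q (congested (Wc D) v)}"
    by (rule inj_on_subset[OF Q_inj_on_Omega_f]) (auto simp: Omega_f'_def)
  have "Q u \<noteq> Q u'"
    if "u \<in> Omega_c D" "snd u = v" "Q u' < Q (congested (Wc D) v)" for u u'
    using Q_congested_ge_Wc[OF that(1)] that by simp
  then show "Q ` ({u \<in> Omega_c D. snd u = v} - {u \<in> Omega_f' D. Q u < Q (congested (Wc D) v)}) \<inter>
      Q ` ({u \<in> Omega_f' D. Q u < Q (congested (Wc D) v)} - {u \<in> Omega_c D. snd u = v}) = {}"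
    by blast
qed

lemma Q_inj_on_marker: "inj_on Q {u \<in> Omega_c D. W D u = w}"
proof (rule inj_onI)
  fix u u' assume "u \<in> {u \<in> Omega_c D. W D u = w}" "u' \<in> {u \<in> Omega_c D. W D u = w}" "Q u = Q u'"
  then have u: "u \<in> Omega_c D" "u' \<in> Omega_c D" "W D u = w" "W D u' = w" "Q u = Q u'" by auto
  note c = Omega_c_props[OF u(1), unfolded u(3)] and c' = Omega_c_props[OF u(2), unfolded u(4)]
  have "\<not> snd u < snd u'" "\<not> snd u' < snd u"
    using Q_congested_strict_mono[OF c(1), of "snd u" "snd u'"]
      Q_congested_strict_mono[OF c(1), of "snd u'" "snd u"] c(2) c'(2) u(5)
    unfolding c(3) c'(3) by auto
  then have "snd u = snd u'" by simp
  then show "u = u'" using c(3) c'(3) by metis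
qed

section \<open>Selection of the pair of maximal flow\<close>

text \<open>
  If the flow is injective on the sets of left and of right states, two pairs with the same common flow
  coincide; maximality of the flow is then strict maximality, which is condition (B).
\<close>

lemma selected_if_maximal:
  assumes "inj_on Q L" "inj_on Q R"
    and A: "\<And>u u'. u \<in> Omega D \<Longrightarrow> u' \<in> Omega D \<Longrightarrow>
      cond_A D ul ur u u' \<longleftrightarrow> u \<in> L \<and> u' \<in> R \<and> Q u = Q u' \<and> Q u' \<le> Q0 D"
    and uh: "uh \<in> Omega_c D" "uh \<in> L" and uk: "uk \<in> Omega D" "uk \<in> R" and "Q uh = Q uk" "Q uk \<le> Q0 D"
    and max: "\<And>u. u \<in> L \<Longrightarrow> Q u \<le> Q0 D \<Longrightarrow> Q u \<le> Q uh"
  shows "selected D ul ur uh uk"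
proof -
  have "uh \<in> Omega D" using uh by (simp add: Omega_def)
  moreover have "Q u < Q uh"
    if "u \<in> Omega D" "u' \<in> Omega D" "(u, u') \<noteq> (uh, uk)" "cond_A D ul ur u u'" for u u'
  proof -
    have u: "u \<in> L" "u' \<in> R" "Q u = Q u'" "Q u' \<le> Q0 D" using A that by auto
    then have "Q u \<noteq> Q uh"
      using assms(1,2) uh uk \<open>Q uh = Q uk\<close> that(3) by (metis inj_onD)
    moreover have "Q u \<le> Q uh" using max[of u] u by simp
    ultimately show ?thesis by simp
  qed
  moreover have "cond_A D ul ur uh uk" using A assms calculation(1) by blast
  ultimately show ?thesis
    using uh(1) uk(1) unfolding selected_def cond_B_def by blast
qed

lemma selected_unique:
  assumes "selected D ul ur uh uk" "selected D ul ur uh' uk'"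
  shows "uh = uh'" "uk = uk'"
proof -
  have "Q u < Q u'"
    if "selected D ul ur u k" "selected D ul ur u' k'" "(u, k) \<noteq> (u', k')" for u k u' k'
  proof -
    have "(u, k) \<in> Omega D \<times> Omega D - {(u', k')}" "cond_A D ul ur u k"
      using that by (auto simp: selected_def Omega_def)
    then show ?thesis using that(2) unfolding selected_def cond_B_def by blast
  qed
  from this[OF assms] this[OF assms(2,1)] have "(uh, uk) = (uh', uk')" by fastforce
  then show "uh = uh'" "uk = uk'" by auto
qed

lemma cond_A_iff:
  assumes N: "(ul, ur) \<in> N_1 D" and u: "uh \<in> Omega D" "uk \<in> Omega D"
    and R: "trace_right (R_1 D uk ur) = uk \<longleftrightarrow> uk \<in> R"
  shows "cond_A D ul ur uh uk \<longleftrightarrow>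
    uh \<in> {u \<in> Omega_c D. W D u = W D ul} \<and> uk \<in> R \<and> Q uh = Q uk \<and> Q uk \<le> Q0 D"
  using left_admissible_iff[OF N_1_D(1)[OF N] u(1) _ N_1_D(3)[OF N] N_1_D(4)[OF N]] R
  by (auto simp: cond_A_def)

text \<open>
  Every flow up to \<open>Q0 < qmax\<close> is attained in free flow, so only the congested side restricts the
  common flow.
\<close>

lemma selection_free_right:
  assumes N: "(ul, ur) \<in> N_1 D" and ur: "ur \<in> Omega_f D"
  shows "\<exists>uh uk. selected D ul ur uh uk \<and> W D uh = W D ul \<and> Q uk = Q uh \<and> uk \<in> Omega_f D \<and>
    (Q (u_c D (W D ul)) < Q0 D \<longrightarrow> uh = u_c D (W D ul)) \<and>
    (Q0 D \<le> Q (u_c D (W D ul)) \<longrightarrow> Q uh = Q0 D)"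
proof -
  let ?w = "W D ul"
  let ?uc = "u_c D ?w" and ?L = "{u \<in> Omega_c D. W D u = W D ul}"
  have w: "?w \<in> markers" using W_in_markers N_1_D(1)[OF N] by simp
  have Vc': "Vc D \<in> {0..Vc D}" using Vc by simp
  note uc = congested_props[OF w Vc', folded u_c_eq]
  have uc_max: "Q u \<le> Q ?uc" if "u \<in> ?L" for u
    using that Q_congested_mono[OF w, of "snd u" "Vc D"] Omega_c_props[of u] by (auto simp: u_c_eq)
  define q where "q = min (Q0 D) (Q ?uc)"
  have "0 < pinv D (?w - Vc D)" using uc(1) Rf by simp
  then have q: "0 \<le> q" "q \<le> Q0 D" "q \<le> Q ?uc" using Q0 Vc by (auto simp: q_def Q_def u_c_eq)
  obtain v where v: "v \<in> {0..Vc D}" "Q (congested ?w v) = q"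
    using congested_flow_attained[OF w q(1)] q(3) by (auto simp: u_c_eq)
  have uh: "congested ?w v \<in> ?L" using congested_props[OF w v(1)] by simp
  obtain uk where uk: "uk \<in> Omega_f D" "Q uk = q"
    using free_flow_attained[of q "Rf'' D"] q Q0 Rf by (auto simp: qmax_def Vmin_def)
  have "selected D ul ur (congested ?w v) uk"
  proof (rule selected_if_maximal[OF Q_inj_on_marker Q_inj_on_Omega_f])
    show "cond_A D ul ur u u' \<longleftrightarrow> u \<in> ?L \<and> u' \<in> Omega_f D \<and> Q u = Q u' \<and> Q u' \<le> Q0 D"
      if "u \<in> Omega D" "u' \<in> Omega D" for u u'
      using cond_A_iff[OF N that right_admissible_free_iff[OF ur that(2)]] .
    show "Q u \<le> Q (congested ?w v)" if "u \<in> ?L" "Q u \<le> Q0 D" for u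
      using uc_max[OF that(1)] that(2) by (simp add: v q_def)
  qed (use uh uk v q in \<open>auto simp: Omega_def\<close>)
  moreover have "congested ?w v = ?uc" if "Q ?uc < Q0 D"
    using Q_inj_on_marker[of ?w] uh uc that v
    by (auto simp: q_def dest: inj_onD)
  ultimately show ?thesis
    using uh uk v by (intro exI[of _ "congested ?w v"] exI[of _ uk]) (auto simp: q_def)
qed

text \<open>
  The flow \<open>Q0\<close> is attained on the left because the intermediate state of marker \<open>w\<^sub>l\<close> and speed
  \<open>v\<^sub>r\<close> carries more. On the right, that state and the one of marker \<open>Wc\<close> bound the flows of the
  congested states of speed \<open>v\<^sub>r\<close>; below this range, \<open>Omega_f'\<close> takes over.
\<close>

lemma selection_congested_right:
  assumes N: "(ul, ur) \<in> N_1 D" and ur: "ur \<in> Omega_c_only D"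
  shows "\<exists>uh uk. selected D ul ur uh uk \<and> W D uh = W D ul \<and> Q uh = Q0 D \<and> Q uk = Q0 D \<and>
    (Q (congested (Wc D) (snd ur)) \<le> Q0 D \<longrightarrow> snd uk = snd ur) \<and>
    (Q0 D < Q (congested (Wc D) (snd ur)) \<longrightarrow> uk \<in> Omega_f' D)"
proof -
  let ?w = "W D ul" and ?vr = "snd ur" and ?L = "{u \<in> Omega_c D. W D u = W D ul}"
  have w: "?w \<in> markers" using W_in_markers N_1_D(1)[OF N] by simp
  have vr: "?vr \<in> {0..Vc D}" "0 < ?vr"
    using Omega_c_props(2)[of ur] ur N_1_D(5)[OF N] by (auto simp: Omega_c_only_iff)
  have Qm: "Q0 D < Q (congested ?w ?vr)" using N_1_D(6)[OF N ur] .
  have "Q (congested ?w ?vr) \<le> Q (congested ?w (Vc D))"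
    using Q_congested_mono[OF w, of ?vr "Vc D"] vr by simp
  then obtain v where v: "v \<in> {0..Vc D}" "Q (congested ?w v) = Q0 D"
    using congested_flow_attained[OF w, of "Q0 D"] Q0 Qm by force
  have uh: "congested ?w v \<in> ?L" using congested_props[OF w v(1)] by simp
  have Wc: "Wc D \<in> markers" using Wc_le_Wmax by simp
  have "\<exists>uk \<in> right_admissible ?vr. uk \<in> Omega D \<and> Q uk = Q0 D \<and>
    (Q (congested (Wc D) ?vr) \<le> Q0 D \<longrightarrow> snd uk = ?vr) \<and>
    (Q0 D < Q (congested (Wc D) ?vr) \<longrightarrow> uk \<in> Omega_f' D)"
  proof (cases "Q0 D < Q (congested (Wc D) ?vr)")
    case True
    \<comment> \<open>\<open>Omega_f'\<close> reaches all flows below that of its upper end \<open>u_f Wc\<close>.\<close>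
    have "Q (congested (Wc D) ?vr) \<le> Rf' D * Vel D (Rf' D)"
      using Q_congested_less_Q_u_f(2)[OF Wc vr(1)]
      by (cases "congested (Wc D) ?vr = u_f D (Wc D)") (auto simp: u_f_Wc Q_def)
    with True have less: "Q0 D < Rf' D * Vel D (Rf' D)" by simp
    then obtain uk where uk: "uk \<in> Omega_f D" "fst uk \<le> Rf' D" "Q uk = Q0 D"
      using free_flow_attained[of "Q0 D" "Rf' D"] Q0 Rf by auto
    then have "uk \<in> Omega_f' D" using less by (auto simp: Omega_f'_def Omega_f_iff Q_def less_le)
    with uk True show ?thesis by (auto simp: right_admissible_def Omega_def)
  next
    case False
    \<comment> \<open>The density at which speed \<open>v\<^sub>r\<close> gives the flow \<open>Q0\<close>; it lies between those of the two
      bounding states, so its marker lies between \<open>Wc\<close> and \<open>w\<^sub>l\<close>.\<close>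
    let ?r = "Q0 D / ?vr"
    note c0 = congested_props[OF Wc vr(1)] and c1 = congested_props[OF w vr(1)]
    have r: "pinv D (Wc D - ?vr) \<le> ?r" "?r \<le> pinv D (?w - ?vr)"
      using False Qm vr(2) by (simp_all add: Q_def pos_le_divide_eq pos_divide_le_eq)
    have "0 < pinv D (Wc D - ?vr)" using c0(1) Rf by simp
    then have "pr D (pinv D (Wc D - ?vr)) \<le> pr D ?r" "pr D ?r \<le> pr D (pinv D (?w - ?vr))"
      using r pr_increasing[of "pinv D (Wc D - ?vr)" ?r] pr_increasing[of ?r "pinv D (?w - ?vr)"]
      by (fastforce simp: le_less)+
    then have "Wc D \<le> ?vr + pr D ?r" "?vr + pr D ?r \<le> Wmax D"
      using c0(2) c1(2) w by auto
    moreover have "Rf' D \<le> ?r" "?r \<le> Rmax D"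
      using r c0(1) c1(3) by (auto simp: Omega_c_def)
    ultimately have "(?r, ?vr) \<in> Omega_c D" using vr(1) by (simp add: Omega_c_def)
    moreover have "Q (?r, ?vr) = Q0 D" using vr by (simp add: Q_def)
    ultimately show ?thesis
      using False by (intro bexI[of _ "(?r, ?vr)"]) (auto simp: right_admissible_def Omega_def)
  qed
  then obtain uk where uk: "uk \<in> right_admissible ?vr" "uk \<in> Omega D" "Q uk = Q0 D"
    "Q (congested (Wc D) ?vr) \<le> Q0 D \<longrightarrow> snd uk = ?vr"
    "Q0 D < Q (congested (Wc D) ?vr) \<longrightarrow> uk \<in> Omega_f' D" by (elim bexE conjE) (rule that)
  have "selected D ul ur (congested ?w v) uk"
  proof (rule selected_if_maximal[OF Q_inj_on_marker Q_inj_on_right_admissible[OF vr(2)]])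
    show "cond_A D ul ur u u' \<longleftrightarrow>
        u \<in> ?L \<and> u' \<in> right_admissible ?vr \<and> Q u = Q u' \<and> Q u' \<le> Q0 D"
      if "u \<in> Omega D" "u' \<in> Omega D" for u u'
      using cond_A_iff[OF N that right_admissible_congested_iff[OF ur vr(2) that(2)]] .
    show "congested ?w v \<in> Omega_c D" "congested ?w v \<in> ?L" using uh by simp_all
    show "uk \<in> Omega D" "uk \<in> right_admissible ?vr" "Q (congested ?w v) = Q uk" "Q uk \<le> Q0 D"
      using uk(1-3) v(2) by simp_all
    show "Q u \<le> Q (congested ?w v)" if "u \<in> ?L" "Q u \<le> Q0 D" for u
      using that(2) v(2) by simp
  qed
  then show ?thesis using uh uk v by (intro exI[of _ "congested ?w v"] exI[of _ uk]) simp
qed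

end

theorem proposition2p1:
  fixes D :: model and ul ur :: state
  assumes "phase_transition_model D"
    and "(ul, ur) \<in> N_1 D"
  shows "(\<exists>!(uh, uk). selected D ul ur uh uk) \<and>
    (\<forall>uh uk. selected D ul ur uh uk \<longrightarrow>
      ((ul, ur) \<in> N_ff D \<union> N_cf D \<longrightarrow>
        (Q0 D > Q (u_c D (W D ul)) \<longrightarrow>
           uh = u_c D (W D ul) \<and> Q uk = Q uh \<and> uk \<in> Omega_f D) \<and>
        (Q0 D \<le> Q (u_c D (W D ul)) \<longrightarrow>
           W D uh = W D ul \<and> Q uh = Q0 D \<and> Q uk = Q0 D \<and> uk \<in> Omega_f D)) \<and>
      ((ul, ur) \<in> N_cc D \<union> N_fc D \<longrightarrow>
        (Q0 D \<ge> pinv D (Wc D - snd ur) * snd ur \<longrightarrow>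
           W D uh = W D ul \<and> Q uh = Q0 D \<and> Q uk = Q0 D \<and> snd uk = snd ur) \<and>
        (Q0 D < pinv D (Wc D - snd ur) * snd ur \<longrightarrow>
           W D uh = W D ul \<and> Q uh = Q0 D \<and> Q uk = Q0 D \<and> uk \<in> Omega_f' D)))"
    (is "?unique \<and> (\<forall>uh uk. selected D ul ur uh uk \<longrightarrow> ?described uh uk)")
proof -
  interpret phase_transition_model D by fact
  have "\<exists>uh uk. selected D ul ur uh uk \<and> ?described uh uk"
  proof (cases "ur \<in> Omega_f D")
    case True
    then have absent: "(ul, ur) \<notin> N_cc D \<union> N_fc D"
      by (simp add: N_cc_def N_fc_def Omega_c_only_def)
    obtain uh uk where sel: "selected D ul ur uh uk"
      and *: "W D uh = W D ul" "Q uk = Q uh" "uk \<in> Omega_f D"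
        "Q (u_c D (W D ul)) < Q0 D \<longrightarrow> uh = u_c D (W D ul)"
        "Q0 D \<le> Q (u_c D (W D ul)) \<longrightarrow> Q uh = Q0 D"
      using selection_free_right[OF assms(2) True] by (elim exE conjE) (rule that)
    from absent * have "?described uh uk" by metis
    with sel show ?thesis by blast
  next
    case False
    then have absent: "(ul, ur) \<notin> N_ff D \<union> N_cf D" by (simp add: N_ff_def N_cf_def)
    have ur: "ur \<in> Omega_c_only D"
      using False N_1_D(2)[OF assms(2)] by (simp add: Omega_def Omega_c_only_def)
    obtain uh uk where sel: "selected D ul ur uh uk"
      and *: "W D uh = W D ul" "Q uh = Q0 D" "Q uk = Q0 D"
        "Q (congested (Wc D) (snd ur)) \<le> Q0 D \<longrightarrow> snd uk = snd ur"
        "Q0 D < Q (congested (Wc D) (snd ur)) \<longrightarrow> uk \<in> Omega_f' D"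
      using selection_congested_right[OF assms(2) ur] by (elim exE conjE) (rule that)
    have "Q (congested (Wc D) (snd ur)) = pinv D (Wc D - snd ur) * snd ur"
      by (simp add: Q_def)
    with absent * have "?described uh uk" by metis
    with sel show ?thesis by blast
  qed
  then obtain uh uk where sel: "selected D ul ur uh uk" and desc: "?described uh uk"
    by (elim exE, elim conjE[of "selected D ul ur uh uk" for uh uk]) (rule that)
  have unique: "uh' = uh \<and> uk' = uk" if "selected D ul ur uh' uk'" for uh' uk'
    using selected_unique[OF that sel] by (rule conjI)
  show ?thesis
  proof (rule conjI)
    show ?unique
    proof (rule ex1I[of _ "(uh, uk)"])
      show "case (uh, uk) of (uh, uk) \<Rightarrow> selected D ul ur uh uk" using sel by simp
      show "u = (uh, uk)" if "case u of (uh, uk) \<Rightarrow> selected D ul ur uh uk" for u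
        using unique that by (cases u) simp
    qed
    show "\<forall>uh uk. selected D ul ur uh uk \<longrightarrow> ?described uh uk"
    proof (intro allI, rule impI)
      fix uh' uk' assume "selected D ul ur uh' uk'"
      then have "uh' = uh" "uk' = uk" using unique by auto
      then show "?described uh' uk'" using desc by (simp only:)
    qed
  qed
qed

end
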